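(* For $\alpha,\alpha'\in\Lambda$, the representations $\pi_\alpha$ and $\pi_{\alpha'}$ of $W$ are unitarily equivalent if and only if $\alpha\sim\alpha'$.
   Context: Fix $d\ge 2$ and complex numbers $q_{ij}$, $1\le i\ne j\le d$, with $|q_{ij}|<1$ and $q_{ij}=\overline{q_{ji}}$. Let $W$ be the universal $C^*$-algebra generated by $s_1,\dots,s_d$ subject to $s_i^*s_i=I$ and $s_i^*s_j=q_{ij}s_js_i^*$ for $i\ne j$. Let $\Lambda_m=\{1,\dots,d\}^m$ ($\Lambda_0=\{\emptyset\}$), $\Lambda^0=\bigcup_m\Lambda_m$, $\Lambda=\{1,\dots,d\}^{\mathbb N}$; $s_\alpha=s_{\alpha_1}\cdots s_{\alpha_m}$, $s_\emptyset=I$. Shifts: $\sigma(\beta_1,\beta_2,\dots)=(\beta_2,\dots)$, $\sigma_j(\beta_1,\beta_2,\dots)=(j,\beta_1,\beta_2,\dots)$. $\beta\sim\alpha$ means $\sigma^m(\beta)=\sigma^n(\alpha)$ for some $m,n\ge0$. Fock representation: $\pi_F$ on $\mathcal F$ with unit vector $\Omega$, $\pi_F(s_j)^*\Omega=0$, and $\pi_F(s_\gamma)\Omega$, $\gamma\in\Lambda^0$, spanning a dense subspace. For $\gamma,\beta\in\Lambda_m$, $q(\gamma,\beta)=\langle\pi_F(s_\gamma)^*\pi_F(s_\beta)\Omega,\Omega\rangle$; for infinite $\gamma,\beta$, $q(\gamma,\beta)=\lim_m q((\gamma_1,\dots,\gamma_m),(\beta_1,\dots,\beta_m))$. $H_\alpha$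 is the Hilbert space completion of the span of formal vectors $e_\beta$, $\beta\sim\alpha$, with respect to the positive form $(e_\beta,e_\gamma)=q(\gamma,\beta)$. The representation $\pi_\alpha$ of $W$ on $H_\alpha$ is given by $\pi_\alpha(s_j)e_\beta=e_{\sigma_j(\beta)}$, and $\pi_\alpha(s_j)^*e_\beta=0$ if $\beta$ does not contain $j$, $\pi_\alpha(s_j)^*e_\beta=q(j,\beta)e_{\beta\setminus j}$ otherwise, where for $\beta=(\beta'j\beta'')$ with $\beta'=(\beta'_1,\dots,\beta'_r)$ not containing $j$, $q(j,\beta)=q_{j\beta'_1}\cdots q_{j\beta'_r}$ and $\beta\setminus j=(\beta'\beta'')$. *)

theory Defs
  imports Complex_Main
begin

type_synonym iword = "nat \<Rightarrow> nat"
type_synonym fvec = "iword \<Rightarrow> complex"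

definition Lam :: "nat \<Rightarrow> iword set" where
  "Lam d = {\<beta>. \<forall>n. \<beta> n \<in> {1..d}}"

definition shift :: "iword \<Rightarrow> iword" where
  "shift \<beta> = (\<lambda>n. \<beta> (Suc n))"

definition shiftj :: "nat \<Rightarrow> iword \<Rightarrow> iword" where
  "shiftj j \<beta> = (\<lambda>n. case n of 0 \<Rightarrow> j | Suc k \<Rightarrow> \<beta> k)"

definition sim :: "iword \<Rightarrow> iword \<Rightarrow> bool" where
  "sim \<beta> \<alpha> \<longleftrightarrow> (\<exists>m n. (shift ^^ m) \<beta> = (shift ^^ n) \<alpha>)"

definition qlet :: "(nat \<Rightarrow> nat \<Rightarrow> complex) \<Rightarrow> nat \<Rightarrow> nat list \<Rightarrow> complex" where
  "qlet Q j xs = (\<Prod>b\<leftarrow>takeWhile (\<lambda>b. b \<noteq> j) xs. Q j b)"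

text \<open>q(gamma,beta) = < pi_F(s_gamma)^* pi_F(s_beta) Omega, Omega > for finite words,
  computed from the relations and pi_F(s_j)^* Omega = 0.\<close>
fun qfin :: "(nat \<Rightarrow> nat \<Rightarrow> complex) \<Rightarrow> nat list \<Rightarrow> nat list \<Rightarrow> complex" where
  "qfin Q [] \<beta> = (if \<beta> = [] then 1 else 0)"
| "qfin Q (j # \<gamma>) \<beta> =
     (if j \<in> set \<beta> then qlet Q j \<beta> * qfin Q \<gamma> (remove1 j \<beta>) else 0)"

definition qinf :: "(nat \<Rightarrow> nat \<Rightarrow> complex) \<Rightarrow> iword \<Rightarrow> iword \<Rightarrow> complex" where
  "qinf Q \<gamma> \<beta> = lim (\<lambda>m. qfin Q (map \<gamma> [0..<m]) (map \<beta> [0..<m]))"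

text \<open>Formal span of e_beta, beta ~ alpha (beta in Lambda): finitely supported coefficient functions.\<close>
definition Hspan :: "nat \<Rightarrow> iword \<Rightarrow> fvec set" where
  "Hspan d \<alpha> = {x. finite {\<beta>. x \<beta> \<noteq> 0} \<and> (\<forall>\<beta>. x \<beta> \<noteq> 0 \<longrightarrow> \<beta> \<in> Lam d \<and> sim \<beta> \<alpha>)}"

definition form :: "(nat \<Rightarrow> nat \<Rightarrow> complex) \<Rightarrow> fvec \<Rightarrow> fvec \<Rightarrow> complex" where
  "form Q x y = (\<Sum>\<beta>\<in>{\<beta>. x \<beta> \<noteq> 0}. \<Sum>\<gamma>\<in>{\<gamma>. y \<gamma> \<noteq> 0}. x \<beta> * cnj (y \<gamma>) * qinf Q \<gamma> \<beta>)"

definition snorm :: "(nat \<Rightarrow> nat \<Rightarrow> complex) \<Rightarrow> fvec \<Rightarrow> real" where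
  "snorm Q x = sqrt (Re (form Q x x))"

text \<open>The completion H_alpha is modelled by Cauchy sequences in the formal span,
  modulo sequences of seminorm tending to 0.\<close>
definition Hseq :: "nat \<Rightarrow> (nat \<Rightarrow> nat \<Rightarrow> complex) \<Rightarrow> iword \<Rightarrow> (nat \<Rightarrow> fvec) \<Rightarrow> bool" where
  "Hseq d Q \<alpha> X \<longleftrightarrow> (\<forall>n. X n \<in> Hspan d \<alpha>) \<and>
     (\<forall>e>0. \<exists>N. \<forall>m\<ge>N. \<forall>n\<ge>N. snorm Q (X m - X n) < e)"

definition Heq :: "(nat \<Rightarrow> nat \<Rightarrow> complex) \<Rightarrow> (nat \<Rightarrow> fvec) \<Rightarrow> (nat \<Rightarrow> fvec) \<Rightarrow> bool" where
  "Heq Q X Y \<longleftrightarrow> (\<lambda>n. snorm Q (X n - Y n)) \<longlonglongrightarrow> 0"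

definition Hinner :: "(nat \<Rightarrow> nat \<Rightarrow> complex) \<Rightarrow> (nat \<Rightarrow> fvec) \<Rightarrow> (nat \<Rightarrow> fvec) \<Rightarrow> complex" where
  "Hinner Q X Y = lim (\<lambda>n. form Q (X n) (Y n))"

definition Hlin :: "complex \<Rightarrow> (nat \<Rightarrow> fvec) \<Rightarrow> complex \<Rightarrow> (nat \<Rightarrow> fvec) \<Rightarrow> (nat \<Rightarrow> fvec)" where
  "Hlin a X b Y = (\<lambda>n \<beta>. a * X n \<beta> + b * Y n \<beta>)"

text \<open>pi_alpha(s_j) e_beta = e_{sigma_j beta}, on coefficient functions.\<close>
definition piS :: "nat \<Rightarrow> fvec \<Rightarrow> fvec" where
  "piS j x = (\<lambda>\<gamma>. if \<gamma> 0 = j then x (shift \<gamma>) else 0)"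

definition unitarily_equivalent ::
  "nat \<Rightarrow> (nat \<Rightarrow> nat \<Rightarrow> complex) \<Rightarrow> iword \<Rightarrow> iword \<Rightarrow> bool" where
  "unitarily_equivalent d Q \<alpha> \<alpha>' \<longleftrightarrow>
    (\<exists>U :: (nat \<Rightarrow> fvec) \<Rightarrow> (nat \<Rightarrow> fvec).
       (\<forall>X. Hseq d Q \<alpha> X \<longrightarrow> Hseq d Q \<alpha>' (U X))
     \<and> (\<forall>X Y. Hseq d Q \<alpha> X \<longrightarrow> Hseq d Q \<alpha> Y \<longrightarrow> Heq Q X Y \<longrightarrow> Heq Q (U X) (U Y))
     \<and> (\<forall>X Y a b. Hseq d Q \<alpha> X \<longrightarrow> Hseq d Q \<alpha> Y \<longrightarrow>
            Heq Q (U (Hlin a X b Y)) (Hlin a (U X) b (U Y)))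
     \<and> (\<forall>X Y. Hseq d Q \<alpha> X \<longrightarrow> Hseq d Q \<alpha> Y \<longrightarrow> Hinner Q (U X) (U Y) = Hinner Q X Y)
     \<and> (\<forall>Y. Hseq d Q \<alpha>' Y \<longrightarrow> (\<exists>X. Hseq d Q \<alpha> X \<and> Heq Q (U X) Y))
     \<and> (\<forall>j\<in>{1..d}. \<forall>X. Hseq d Q \<alpha> X \<longrightarrow>
            Heq Q (U (\<lambda>n. piS j (X n))) (\<lambda>n. piS j (U X n))))"

end

theory Submission
  imports Defs "HOL-Library.Multiset"
begin

text \<open>
  If \<open>\<alpha> \<sim> \<alpha>'\<close>, the two representations coincide. Conversely, let \<open>U\<close> be an intertwiner. Since
  \<open>e\<^sub>\<alpha> = s\<^sub>1 \<cdots> s\<^sub>m e\<^sub>m\<close> with \<open>s\<^sub>i = \<pi>(s\<^bsub>\<alpha>\<^sub>i\<^esub>)\<close> and the unit vector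
  \<open>e\<^sub>m\<close> indexed by the \<open>m\<close>-th shift of \<open>\<alpha>\<close>, the inner product of \<open>e\<^sub>\<beta>\<close> and \<open>U e\<^sub>\<alpha>\<close> is that
  of \<open>s\<^sub>m\<^sup>* \<cdots> s\<^sub>1\<^sup>* e\<^sub>\<beta>\<close> and \<open>U e\<^sub>m\<close>. Every adjoint deletes a letter
  and contributes a factor of modulus at most \<open>max |q\<^sub>i\<^sub>j| < 1\<close> unless the letter deleted is the
  first one. If \<open>\<beta> \<sim> \<alpha>'\<close> but \<open>\<alpha>\<close> is not equivalent to \<open>\<alpha>'\<close>, infinitely many deletions are of
  the former kind, so \<open>U e\<^sub>\<alpha>\<close> is orthogonal to every \<open>e\<^sub>\<beta>\<close> and vanishes, contradicting
  \<open>\<parallel>e\<^sub>\<alpha>\<parallel> = 1\<close>.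

  The estimates need the Cauchy-Schwarz inequality, hence positivity of the form. For words with the
  same letters, \<open>q(\<gamma>,\<beta>)\<close> is a product over the pairs of (labelled) letters occurring in different
  order, so its Gram matrix is a Schur product of pullbacks of 2-by-2 matrices with diagonal entries
  1 and off-diagonal entries \<open>q\<^sub>i\<^sub>j\<close>, \<open>q\<^sub>j\<^sub>i\<close>.
\<close>

subsection \<open>The coefficients \<open>q(\<gamma>,\<beta>)\<close> of finite words\<close>

lemma qlet_simps [simp]:
  "qlet Q j [] = 1"
  "qlet Q j (b # xs) = (if b = j then 1 else Q j b * qlet Q j xs)"
  by (auto simp: qlet_def)

lemma mset_eq_if_qfin_nonzero: "qfin Q \<gamma> \<beta> \<noteq> 0 \<Longrightarrow> mset \<gamma> = mset \<beta>"
  by (induction \<gamma> arbitrary: \<beta>) (auto split: if_splits)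

lemma qfin_refl [simp]: "qfin Q \<gamma> \<gamma> = 1"
  by (induction \<gamma>) auto

lemma qlet_append: "j \<in> set xs \<Longrightarrow> qlet Q j (xs @ ys) = qlet Q j xs"
  by (induction xs) auto

lemma qlet_append_notin: "j \<notin> set xs \<Longrightarrow> qlet Q j (xs @ ys) = (\<Prod>b\<leftarrow>xs. Q j b) * qlet Q j ys"
  by (induction xs) (auto simp: mult.assoc)

text \<open>With equal letter multisets, every letter of \<open>\<gamma>\<close> finds its first
  occurrence inside the block \<open>\<beta>\<close>, so \<open>qlet\<close> never reads
  \<open>\<beta>'\<close>; once \<open>\<gamma>\<close> is used up, so is
  \<open>\<beta>\<close>.\<close>

lemma qfin_append:
  assumes "mset \<gamma> = mset \<beta>"
  shows "qfin Q (\<gamma> @ \<gamma>') (\<beta> @ \<beta>') = qfin Q \<gamma> \<beta> * qfin Q \<gamma>' \<beta>'"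
  using assms
proof (induction \<gamma> arbitrary: \<beta>)
  case (Cons j \<gamma>)
  have j: "j \<in> set \<beta>"
    using Cons.prems by (metis list.set_intros(1) set_mset_mset)
  have "mset \<gamma> = mset (remove1 j \<beta>)"
    using Cons.prems by (metis add_mset_remove_trivial mset.simps(2) mset_remove1)
  then show ?case
    using Cons.IH[of "remove1 j \<beta>"] j by (simp add: qlet_append remove1_append mult.assoc)
qed simp

section \<open>Splitting one letter off a pair of finite words\<close>

definition count_before :: "'a \<Rightarrow> 'a \<Rightarrow> 'a list \<Rightarrow> nat" where
  "count_before c b xs = count_list (takeWhile (\<lambda>x. x \<noteq> c) xs) b"

lemma count_before_simps [simp]:
  "count_before c b [] = 0"
  "count_before c b (x # xs) =
     (if x = c then 0 else if x = b then Suc (count_before c b xs) else count_before c b xs)"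
  by (cases "x = c"; cases "x = b"; simp add: count_before_def)+

lemma qlet_eq_prod_power:
  assumes "finite A" "set xs \<subseteq> A"
  shows "qlet Q c xs = (\<Prod>b\<in>A - {c}. Q c b ^ count_before c b xs)"
  using assms(2)
proof (induction xs)
  case (Cons x xs)
  show ?case
  proof (cases "x = c")
    case False
    have "(\<Prod>b\<in>A - {c}. Q c b ^ count_before c b (x # xs)) =
        (\<Prod>b\<in>A - {c}. (if x = b then Q c b else 1) * Q c b ^ count_before c b xs)"
      using False by (intro prod.cong) auto
    also have "\<dots> = Q c x * qlet Q c xs"
      using False Cons assms(1) by (simp add: prod.distrib)
    finally show ?thesis using False by simp
  qed simp
qed simp

text \<open>The cost of aligning the first \<open>c\<close> with respect to one other letter
  \<open>b\<close>, when it stands behind \<open>u\<close> copies of \<open>b\<close> in one word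
  and behind \<open>v\<close> in the other. Each unit of difference is one crossing, weighted by
  \<open>Q c b\<close> or \<open>Q b c\<close> according to its direction.\<close>

definition run_kernel :: "(nat \<Rightarrow> nat \<Rightarrow> complex) \<Rightarrow> nat \<Rightarrow> nat \<Rightarrow> nat \<Rightarrow> nat \<Rightarrow> complex" where
  "run_kernel Q c b u v = (if u \<le> v then Q c b ^ (v - u) else Q b c ^ (u - v))"

lemma count_before_remove1:
  assumes "b \<noteq> j" "c \<noteq> j"
  shows "count_before c b (remove1 j xs) = count_before c b xs"
  using assms by (induction xs) auto

text \<open>If the first \<open>c\<close> precedes the first \<open>j\<close>, both sides carry one
  extra factor \<open>Q j c\<close>, on the left from \<open>qlet\<close> and on the right from
  \<open>Suc u\<close>. Otherwise \<open>qlet\<close> is unaffected and both counts grow by one,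
  which leaves \<open>run_kernel\<close> unchanged.\<close>

lemma qlet_run_kernel_shift:
  assumes "c \<noteq> j" "c \<in> set xs" "j \<in> set xs"
  shows "qlet Q j xs * run_kernel Q c j u (count_before c j (remove1 j xs)) =
    qlet Q j (remove1 c xs) * run_kernel Q c j (Suc u) (count_before c j xs)"
  using assms
proof (induction xs)
  case (Cons x xs)
  then show ?case by (cases "x = c"; cases "x = j") (auto simp: run_kernel_def)
qed simp

text \<open>The letters other than \<open>c\<close> that have to be carried across the first \<open>c\<close> are separated off;
  iterating this exhibits the Gram matrix as a Schur product.\<close>
lemma qfin_remove1:
  assumes "finite A" "set \<gamma> \<subseteq> A" "mset \<gamma> = mset \<beta>" "c \<in> set \<gamma>"
  shows "qfin Q \<gamma> \<beta> = qfin Q (remove1 c \<gamma>) (remove1 c \<beta>) *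
    (\<Prod>b\<in>A - {c}. run_kernel Q c b (count_before c b \<gamma>) (count_before c b \<beta>))"
  using assms(2-)
proof (induction \<gamma> arbitrary: \<beta>)
  case (Cons j \<gamma>)
  have set_eq: "set \<beta> = insert j (set \<gamma>)"
    using Cons.prems(2) by (metis list.simps(15) set_mset_mset)
  show ?case
  proof (cases "j = c")
    case True
    have "qlet Q c \<beta> = (\<Prod>b\<in>A - {c}. run_kernel Q c b 0 (count_before c b \<beta>))"
      using qlet_eq_prod_power[OF assms(1), of \<beta> Q c] set_eq Cons.prems(1)
      by (auto simp: run_kernel_def)
    then show ?thesis using True set_eq by simp
  next
    case False
    have c: "c \<in> set \<gamma>" using False Cons.prems(3) by auto
    have m: "mset \<gamma> = mset (remove1 j \<beta>)"
      using Cons.prems(2) by (metis add_mset_remove_trivial mset.simps(2) mset_remove1)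
    let ?k = "\<lambda>b. run_kernel Q c b (count_before c b \<gamma>) (count_before c b (remove1 j \<beta>))"
    let ?l = "\<lambda>b. run_kernel Q c b (count_before c b (j # \<gamma>)) (count_before c b \<beta>)"
    \<comment> \<open>Deleting \<open>j\<close> changes only the number of letters \<open>j\<close>
      before the first \<open>c\<close>, so that factor is isolated and the others agree.\<close>
    have split: "(\<Prod>b\<in>A - {c}. f b) = f j * (\<Prod>b\<in>A - {c} - {j}. f b)" for f :: "nat \<Rightarrow> complex"
      using assms(1) Cons.prems(1) False by (intro prod.remove) auto
    have rest: "(\<Prod>b\<in>A - {c} - {j}. ?k b) = (\<Prod>b\<in>A - {c} - {j}. ?l b)"
      using False by (intro prod.cong) (auto simp: count_before_remove1)
    have shift: "qlet Q j \<beta> * ?k j = qlet Q j (remove1 c \<beta>) * ?l j"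
      using qlet_run_kernel_shift[of c j \<beta> Q "count_before c j \<gamma>"] False set_eq c by simp
    have jc: "j \<in> set (remove1 c \<beta>)" using False set_eq by simp
    have "qfin Q (j # \<gamma>) \<beta> =
        qlet Q j \<beta> * (qfin Q (remove1 c \<gamma>) (remove1 c (remove1 j \<beta>)) * (\<Prod>b\<in>A - {c}. ?k b))"
      using Cons.IH[OF _ m c] Cons.prems(1) set_eq by simp
    also have "\<dots> = qfin Q (remove1 c \<gamma>) (remove1 j (remove1 c \<beta>)) *
        ((qlet Q j \<beta> * ?k j) * (\<Prod>b\<in>A - {c} - {j}. ?k b))"
      by (simp add: split remove1_commute[of c j] mult_ac)
    also have "\<dots> = (qlet Q j (remove1 c \<beta>) * qfin Q (remove1 c \<gamma>) (remove1 j (remove1 c \<beta>))) *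
        (\<Prod>b\<in>A - {c}. ?l b)"
      unfolding shift rest split[of ?l] by (simp add: mult_ac)
    finally show ?thesis using False jc by simp
  qed
qed simp

subsection \<open>Positive semidefinite kernels\<close>

text \<open>The first argument of \<open>K\<close> goes with the conjugated coefficient, as in
  \<open>form\<close>. Vanishing of the imaginary part is included because hermitian symmetry is
  later recovered from it by polarization.\<close>

definition psd_on :: "'a set \<Rightarrow> ('a \<Rightarrow> 'a \<Rightarrow> complex) \<Rightarrow> bool" where
  "psd_on S K \<longleftrightarrow> (\<forall>x. let z = \<Sum>\<beta>\<in>S. \<Sum>\<gamma>\<in>S. x \<beta> * cnj (x \<gamma>) * K \<gamma> \<beta> in Im z = 0 \<and> Re z \<ge> 0)"

lemma psd_on_cong:
  assumes "psd_on S K" "\<And>\<gamma> \<beta>. \<gamma> \<in> S \<Longrightarrow> \<beta> \<in> S \<Longrightarrow> K \<gamma> \<beta> = L \<gamma> \<beta>"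
  shows "psd_on S L"
proof -
  have "(\<Sum>\<beta>\<in>S. \<Sum>\<gamma>\<in>S. x \<beta> * cnj (x \<gamma>) * K \<gamma> \<beta>) = (\<Sum>\<beta>\<in>S. \<Sum>\<gamma>\<in>S. x \<beta> * cnj (x \<gamma>) * L \<gamma> \<beta>)" for x
    using assms(2) by (intro sum.cong refl) simp
  then show ?thesis using assms(1) by (simp add: psd_on_def)
qed

lemma psd_on_const_1: "psd_on S (\<lambda>\<gamma> \<beta>. 1)"
proof -
  have "(\<Sum>\<beta>\<in>S. \<Sum>\<gamma>\<in>S. x \<beta> * cnj (x \<gamma>)) = complex_of_real ((cmod (sum x S))\<^sup>2)" for x
    by (simp only: complex_norm_square cnj_sum sum_product)
  then show ?thesis by (simp add: psd_on_def)
qed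

lemma psd_on_add:
  assumes "psd_on S K" "psd_on S L"
  shows "psd_on S (\<lambda>\<gamma> \<beta>. K \<gamma> \<beta> + L \<gamma> \<beta>)"
  using assms by (simp add: psd_on_def Let_def ring_distribs sum.distrib)

lemma psd_on_scale:
  assumes "psd_on S K" "0 \<le> t"
  shows "psd_on S (\<lambda>\<gamma> \<beta>. complex_of_real t * K \<gamma> \<beta>)"
proof -
  have "(\<Sum>\<beta>\<in>S. \<Sum>\<gamma>\<in>S. x \<beta> * cnj (x \<gamma>) * (complex_of_real t * K \<gamma> \<beta>)) =
     complex_of_real t * (\<Sum>\<beta>\<in>S. \<Sum>\<gamma>\<in>S. x \<beta> * cnj (x \<gamma>) * K \<gamma> \<beta>)" for x
    by (simp add: sum_distrib_left mult_ac)
  then show ?thesis using assms by (simp add: psd_on_def)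
qed

text \<open>The rank-one factor is absorbed into the coefficients, replacing \<open>x\<close> by the
  pointwise product of \<open>x\<close> and \<open>v\<close>.\<close>

lemma psd_on_rank_one_mult:
  assumes "psd_on S K"
  shows "psd_on S (\<lambda>\<gamma> \<beta>. K \<gamma> \<beta> * (v \<beta> * cnj (v \<gamma>)))"
  unfolding psd_on_def
proof
  fix x
  have "(\<Sum>\<beta>\<in>S. \<Sum>\<gamma>\<in>S. x \<beta> * cnj (x \<gamma>) * (K \<gamma> \<beta> * (v \<beta> * cnj (v \<gamma>)))) =
      (\<Sum>\<beta>\<in>S. \<Sum>\<gamma>\<in>S. (x \<beta> * v \<beta>) * cnj (x \<gamma> * v \<gamma>) * K \<gamma> \<beta>)"
    by (intro sum.cong refl) (simp add: mult_ac)
  then show "let z = \<Sum>\<beta>\<in>S. \<Sum>\<gamma>\<in>S. x \<beta> * cnj (x \<gamma>) * (K \<gamma> \<beta> * (v \<beta> * cnj (v \<gamma>)))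
      in Im z = 0 \<and> 0 \<le> Re z"
    using assms[unfolded psd_on_def, rule_format, of "\<lambda>\<beta>. x \<beta> * v \<beta>"] by simp
qed

text \<open>The 2-by-2 matrix with diagonal 1 and off-diagonal \<open>q\<close>,
  \<open>cnj q\<close> is a rank-one matrix plus 1 - |q|^2 times another, given by \<open>?v\<close>
  and \<open>?w\<close>.\<close>

lemma psd_on_threshold_mult:
  assumes "psd_on S K" "cmod q \<le> 1"
  shows "psd_on S (\<lambda>\<gamma> \<beta>. K \<gamma> \<beta> * (if P \<gamma> = P \<beta> then 1 else if P \<beta> then q else cnj q))"
proof -
  let ?v = "\<lambda>\<beta>. if P \<beta> then q else 1" and ?w = "\<lambda>\<beta>. if P \<beta> then 1 else 0"
  have "(cmod q)\<^sup>2 \<le> 1" using assms(2) by (simp add: power_le_one)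
  then have "psd_on S (\<lambda>\<gamma> \<beta>. K \<gamma> \<beta> * (?v \<beta> * cnj (?v \<gamma>)) +
      complex_of_real (1 - (cmod q)\<^sup>2) * (K \<gamma> \<beta> * (?w \<beta> * cnj (?w \<gamma>))))"
    by (intro psd_on_add psd_on_scale psd_on_rank_one_mult assms(1)) simp
  then show ?thesis
    by (rule psd_on_cong) (auto simp: algebra_simps simp flip: complex_norm_square)
qed

text \<open>The kernel is a product over thresholds \<open>n\<close>: a factor \<open>Q c b\<close>
  or its conjugate appears exactly when \<open>n\<close> separates the two counts. Truncating both
  counts with \<open>min\<close> turns this into an induction on the number of thresholds.\<close>

lemma psd_on_run_kernel_mult:
  assumes "psd_on S K" "finite S" "cmod (Q c b) \<le> 1" "Q b c = cnj (Q c b)"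
  shows "psd_on S (\<lambda>\<gamma> \<beta>. K \<gamma> \<beta> * run_kernel Q c b (f \<gamma>) (f \<beta>))"
proof -
  have step: "run_kernel Q c b (min u (Suc n)) (min v (Suc n)) =
      run_kernel Q c b (min u n) (min v n) *
      (if (n < u) = (n < v) then 1 else if n < v then Q c b else cnj (Q c b))" for u v n
  proof -
    have "min w (Suc n) = (if n < w then Suc n else w)" "min w n = (if n < w then n else w)" for w
      by auto
    then show ?thesis
      by (auto simp: run_kernel_def assms(4) Suc_diff_le not_less)
  qed
  have "psd_on S (\<lambda>\<gamma> \<beta>. K \<gamma> \<beta> * run_kernel Q c b (min (f \<gamma>) n) (min (f \<beta>) n))" for n
  proof (induction n)
    case 0
    then show ?case using assms(1) by (simp add: run_kernel_def)
  next
    case (Suc n)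
    show ?case
      using psd_on_threshold_mult[OF Suc assms(3), of "\<lambda>\<gamma>. n < f \<gamma>"]
      by (simp add: step mult.assoc)
  qed
  \<comment> \<open>At this height the truncation no longer affects any element of
    \<open>S\<close>.\<close>
  from this[of "Max (f ` S)"] show ?thesis
    by (rule psd_on_cong) (simp add: assms(2) min_def)
qed

lemma psd_on_run_kernels_mult:
  assumes "psd_on S K" "finite S" "finite B"
    and "\<And>b. b \<in> B \<Longrightarrow> cmod (Q c b) \<le> 1 \<and> Q b c = cnj (Q c b)"
  shows "psd_on S (\<lambda>\<gamma> \<beta>. K \<gamma> \<beta> * (\<Prod>b\<in>B. run_kernel Q c b (f b \<gamma>) (f b \<beta>)))"
  using assms(3,4)
proof (induction B rule: finite_induct)
  case (insert b B)
  then show ?case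
    using psd_on_run_kernel_mult[OF insert.IH assms(2), of Q c b "f b"] by (simp add: mult_ac)
qed (simp add: assms(1))

text \<open>The kernel is block diagonal along the fibres of \<open>f\<close>, so its quadratic form
  is the sum of those of the blocks.\<close>

lemma psd_on_fibres:
  assumes "finite S" "\<And>t. psd_on {\<beta> \<in> S. f \<beta> = t} K"
    and "\<And>\<gamma> \<beta>. \<gamma> \<in> S \<Longrightarrow> \<beta> \<in> S \<Longrightarrow> f \<gamma> \<noteq> f \<beta> \<Longrightarrow> K \<gamma> \<beta> = 0"
  shows "psd_on S K"
  unfolding psd_on_def
proof
  fix x
  let ?F = "\<lambda>t. {\<beta> \<in> S. f \<beta> = t}"
  let ?z = "\<lambda>t. \<Sum>\<beta>\<in>?F t. \<Sum>\<gamma>\<in>?F t. x \<beta> * cnj (x \<gamma>) * K \<gamma> \<beta>"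
  have "(\<Sum>\<beta>\<in>S. \<Sum>\<gamma>\<in>S. x \<beta> * cnj (x \<gamma>) * K \<gamma> \<beta>) =
      (\<Sum>t\<in>f ` S. \<Sum>\<beta>\<in>?F t. \<Sum>\<gamma>\<in>S. x \<beta> * cnj (x \<gamma>) * K \<gamma> \<beta>)"
    using assms(1) by (intro sum.group[symmetric]) auto
  also have "\<dots> = (\<Sum>t\<in>f ` S. ?z t)"
    using assms(1,3) by (intro sum.cong refl sum.mono_neutral_right) auto
  finally have eq: "(\<Sum>\<beta>\<in>S. \<Sum>\<gamma>\<in>S. x \<beta> * cnj (x \<gamma>) * K \<gamma> \<beta>) = (\<Sum>t\<in>f ` S. ?z t)" .
  have "Im (?z t) = 0 \<and> Re (?z t) \<ge> 0" for t
    using assms(2)[of t] by (simp add: psd_on_def Let_def)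
  then have "Im (\<Sum>t\<in>f ` S. ?z t) = 0" "Re (\<Sum>t\<in>f ` S. ?z t) \<ge> 0"
    by (simp_all only: Im_sum Re_sum sum_nonneg sum.neutral_const)
  then show "let z = \<Sum>\<beta>\<in>S. \<Sum>\<gamma>\<in>S. x \<beta> * cnj (x \<gamma>) * K \<gamma> \<beta> in Im z = 0 \<and> 0 \<le> Re z"
    by (simp only: eq Let_def)
qed

subsection \<open>Positivity and convergence of the coefficients\<close>

locale q_system =
  fixes d :: nat and Q :: "nat \<Rightarrow> nat \<Rightarrow> complex"
  assumes Q_less_1: "i \<in> {1..d} \<Longrightarrow> j \<in> {1..d} \<Longrightarrow> i \<noteq> j \<Longrightarrow> cmod (Q i j) < 1"
    and Q_cnj: "i \<in> {1..d} \<Longrightarrow> j \<in> {1..d} \<Longrightarrow> i \<noteq> j \<Longrightarrow> Q i j = cnj (Q j i)"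
begin

text \<open>Induction on the common multiset, peeling one letter \<open>c\<close> off every word at
  once by \<open>qfin_remove1\<close>. The labelling \<open>w\<close> is generalized so that the
  hypothesis applies to the shortened words.\<close>

lemma psd_qfin_mset:
  assumes "finite S" "set_mset A \<subseteq> {1..d}" "\<And>\<gamma>. \<gamma> \<in> S \<Longrightarrow> mset (w \<gamma>) = A"
  shows "psd_on S (\<lambda>\<gamma> \<beta>. qfin Q (w \<gamma>) (w \<beta>))"
  using assms(2,3)
proof (induction A arbitrary: w)
  case empty
  then show ?case by (intro psd_on_cong[OF psd_on_const_1]) auto
next
  case (add c A)
  have "psd_on S (\<lambda>\<gamma> \<beta>. qfin Q (remove1 c (w \<gamma>)) (remove1 c (w \<beta>)))"
    using add by auto
  moreover have "cmod (Q c b) \<le> 1 \<and> Q b c = cnj (Q c b)" if "b \<in> {1..d} - {c}" for b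
    using that add.prems(1) Q_less_1[of c b] Q_cnj[of b c] by auto
  ultimately have "psd_on S (\<lambda>\<gamma> \<beta>. qfin Q (remove1 c (w \<gamma>)) (remove1 c (w \<beta>)) *
      (\<Prod>b\<in>{1..d} - {c}. run_kernel Q c b (count_before c b (w \<gamma>)) (count_before c b (w \<beta>))))"
    using assms(1) by (intro psd_on_run_kernels_mult) auto
  then show ?case
  proof (rule psd_on_cong)
    fix \<gamma> \<beta> assume "\<gamma> \<in> S" "\<beta> \<in> S"
    then have m: "mset (w \<gamma>) = add_mset c A" "mset (w \<beta>) = add_mset c A" using add.prems by auto
    then have "set (w \<gamma>) = set_mset (add_mset c A)" by (metis set_mset_mset)
    with m add.prems(1) show "qfin Q (remove1 c (w \<gamma>)) (remove1 c (w \<beta>)) *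
      (\<Prod>b\<in>{1..d} - {c}. run_kernel Q c b (count_before c b (w \<gamma>)) (count_before c b (w \<beta>)))
      = qfin Q (w \<gamma>) (w \<beta>)"
      by (intro qfin_remove1[symmetric]) auto
  qed
qed

lemma psd_qfin:
  assumes "finite S" "\<And>\<gamma>. \<gamma> \<in> S \<Longrightarrow> set (w \<gamma>) \<subseteq> {1..d}"
  shows "psd_on S (\<lambda>\<gamma> \<beta>. qfin Q (w \<gamma>) (w \<beta>))"
proof (rule psd_on_fibres[where f = "\<lambda>\<gamma>. mset (w \<gamma>)"])
  fix t
  show "psd_on {\<beta> \<in> S. mset (w \<beta>) = t} (\<lambda>\<gamma> \<beta>. qfin Q (w \<gamma>) (w \<beta>))"
  proof (cases "{\<beta> \<in> S. mset (w \<beta>) = t} = {}")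
    case True
    then show ?thesis unfolding True by (simp add: psd_on_def)
  next
    case False
    then obtain \<beta> where "\<beta> \<in> S" "mset (w \<beta>) = t" by blast
    then have "set_mset t \<subseteq> {1..d}" using assms(2)[of \<beta>] by auto
    then show ?thesis using assms(1) by (intro psd_qfin_mset[of _ t]) auto
  qed
next
  show "qfin Q (w \<gamma>) (w \<beta>) = 0" if "mset (w \<gamma>) \<noteq> mset (w \<beta>)" for \<gamma> \<beta>
    using that mset_eq_if_qfin_nonzero by blast
qed (rule assms(1))

text \<open>A maximum over finitely many pairs stays strictly below 1, which gives a uniform decay
  rate. The inserted 0 keeps the set nonempty.\<close>

definition q_max :: real where
  "q_max = Max (insert 0 ((\<lambda>(i, j). cmod (Q i j)) ` {(i, j). i \<in> {1..d} \<and> j \<in> {1..d} \<and> i \<noteq> j}))"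

lemma finite_pairs: "finite {(i, j). i \<in> {1..d} \<and> j \<in> {1..d} \<and> i \<noteq> j}"
  by (rule finite_subset[of _ "{1..d} \<times> {1..d}"]) auto

lemma q_max_nonneg: "0 \<le> q_max"
  unfolding q_max_def using finite_pairs by (intro Max_ge) auto

lemma q_max_less_1: "q_max < 1"
  unfolding q_max_def using finite_pairs by (subst Max_less_iff) (auto intro!: Q_less_1)

lemma Q_le_q_max: "i \<in> {1..d} \<Longrightarrow> j \<in> {1..d} \<Longrightarrow> i \<noteq> j \<Longrightarrow> cmod (Q i j) \<le> q_max"
  unfolding q_max_def using finite_pairs by (intro Max_ge) auto

lemma cmod_prod_list_Q_le_1:
  "j \<in> {1..d} \<Longrightarrow> set xs \<subseteq> {1..d} \<Longrightarrow> j \<notin> set xs \<Longrightarrow> cmod (\<Prod>b\<leftarrow>xs. Q j b) \<le> 1"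
proof (induction xs)
  case (Cons b xs)
  then show ?case
    using Q_less_1[of j b] by (auto simp: norm_mult intro!: mult_le_one)
qed simp

lemma cmod_qlet_le_1:
  assumes "j \<in> {1..d}" "set xs \<subseteq> {1..d}"
  shows "cmod (qlet Q j xs) \<le> 1"
  unfolding qlet_def
  using assms by (intro cmod_prod_list_Q_le_1) (auto dest: set_takeWhileD)

lemma cmod_qfin_le_1:
  "set \<gamma> \<subseteq> {1..d} \<Longrightarrow> set \<beta> \<subseteq> {1..d} \<Longrightarrow> cmod (qfin Q \<gamma> \<beta>) \<le> 1"
proof (induction \<gamma> arbitrary: \<beta>)
  case (Cons j \<gamma>)
  have "cmod (qfin Q \<gamma> (remove1 j \<beta>)) \<le> 1"
    using Cons.prems set_remove1_subset[of j \<beta>] by (intro Cons.IH) auto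
  then show ?case
    using cmod_qlet_le_1[of j \<beta>] Cons.prems by (auto simp: norm_mult intro!: mult_le_one)
qed simp

text \<open>At the first mismatch the letter required by \<open>\<gamma>\<close> is not in front, so
  it must cross the front letter or is absent; all remaining factors have modulus at most 1.\<close>

lemma cmod_qfin_le_q_max:
  "set \<gamma> \<subseteq> {1..d} \<Longrightarrow> set \<beta> \<subseteq> {1..d} \<Longrightarrow> length \<gamma> = length \<beta> \<Longrightarrow> \<gamma> \<noteq> \<beta> \<Longrightarrow>
    cmod (qfin Q \<gamma> \<beta>) \<le> q_max"
proof (induction \<gamma> arbitrary: \<beta>)
  case (Cons j \<gamma>)
  then obtain b \<beta>' where \<beta>: "\<beta> = b # \<beta>'" by (cases \<beta>) auto
  show ?case
  proof (cases "b = j")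
    case True
    then show ?thesis using Cons \<beta> by auto
  next
    case False
    have 1: "cmod (qfin Q \<gamma> (remove1 j \<beta>)) \<le> 1"
      using Cons.prems set_remove1_subset[of j \<beta>] by (intro cmod_qfin_le_1) auto
    have "cmod (qlet Q j \<beta>) = cmod (Q j b) * cmod (qlet Q j \<beta>')"
      using False \<beta> by (simp add: norm_mult)
    also have "\<dots> \<le> q_max * 1"
      using Cons.prems \<beta> False q_max_nonneg
      by (intro mult_mono cmod_qlet_le_1 Q_le_q_max) auto
    finally have "cmod (qlet Q j \<beta>) * cmod (qfin Q \<gamma> (remove1 j \<beta>)) \<le> q_max * 1"
      using 1 q_max_nonneg by (intro mult_mono) auto
    then show ?thesis using q_max_nonneg by (simp add: norm_mult)
  qed
qed simp

section \<open>Limits along prefixes of infinite words\<close>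

definition qpre :: "iword \<Rightarrow> iword \<Rightarrow> nat \<Rightarrow> complex" where
  "qpre \<gamma> \<beta> m = qfin Q (map \<gamma> [0..<m]) (map \<beta> [0..<m])"

lemma set_prefix: "\<beta> \<in> Lam d \<Longrightarrow> set (map \<beta> [k..<m]) \<subseteq> {1..d}"
  by (auto simp: Lam_def)

lemma qpre_split:
  assumes "mset (map \<gamma> [0..<k]) = mset (map \<beta> [0..<k])" "k \<le> m"
  shows "qpre \<gamma> \<beta> m = qpre \<gamma> \<beta> k * qfin Q (map \<gamma> [k..<m]) (map \<beta> [k..<m])"
proof -
  have "[0..<m] = [0..<k] @ [k..<m]" using assms(2) upt_add_eq_append[of 0 k "m - k"] by simp
  then show ?thesis using qfin_append[OF assms(1)] by (simp add: qpre_def)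
qed

lemma qpre_eq_0: "mset (map \<gamma> [0..<m]) \<noteq> mset (map \<beta> [0..<m]) \<Longrightarrow> qpre \<gamma> \<beta> m = 0"
  using mset_eq_if_qfin_nonzero unfolding qpre_def by blast

text \<open>Whenever the prefixes balance, that is, have equal multisets, \<open>qpre_split\<close>
  detaches the later letters; a later mismatch then contributes a fresh factor \<open>q_max\<close>.
  If the prefixes stop balancing, the values are 0.\<close>

lemma qpre_power_bound:
  assumes "\<gamma> \<in> Lam d" "\<beta> \<in> Lam d" "\<And>N. \<exists>n\<ge>N. \<gamma> n \<noteq> \<beta> n"
  shows "\<exists>M. \<forall>m\<ge>M. cmod (qpre \<gamma> \<beta> m) \<le> q_max ^ k"
proof (induction k)
  case 0
  have "cmod (qpre \<gamma> \<beta> m) \<le> 1" for m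
    unfolding qpre_def by (intro cmod_qfin_le_1 set_prefix assms(1,2))
  then show ?case by simp
next
  case (Suc k)
  then obtain M where M: "\<And>m. m \<ge> M \<Longrightarrow> cmod (qpre \<gamma> \<beta> m) \<le> q_max ^ k" by blast
  show ?case
  proof (cases "\<exists>l\<ge>M. mset (map \<gamma> [0..<l]) = mset (map \<beta> [0..<l])")
    case False
    then show ?thesis using qpre_eq_0 q_max_nonneg by (intro exI[of _ M]) auto
  next
    case True
    then obtain l where l: "l \<ge> M" "mset (map \<gamma> [0..<l]) = mset (map \<beta> [0..<l])" by blast
    obtain n where n: "n \<ge> l" "\<gamma> n \<noteq> \<beta> n" using assms(3) by blast
    have "cmod (qpre \<gamma> \<beta> m) \<le> q_max ^ Suc k" if m: "m \<ge> Suc n" for m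
    proof -
      have "n \<in> set [l..<m]" using n m by auto
      then have ne: "map \<gamma> [l..<m] \<noteq> map \<beta> [l..<m]"
        using n(2) by (auto simp: map_eq_conv)
      have "cmod (qpre \<gamma> \<beta> m) =
          cmod (qfin Q (map \<gamma> [l..<m]) (map \<beta> [l..<m])) * cmod (qpre \<gamma> \<beta> l)"
        using qpre_split[OF l(2), of m] n m by (simp add: norm_mult mult.commute)
      also have "\<dots> \<le> q_max * q_max ^ k"
        using ne M[OF l(1)] q_max_nonneg assms set_prefix
        by (intro mult_mono cmod_qfin_le_q_max) auto
      finally show ?thesis by simp
    qed
    then show ?thesis by blast
  qed
qed

text \<open>This makes the \<open>lim\<close> in \<open>qinf\<close> a genuine limit. Words that
  eventually agree give an eventually constant sequence; words that differ infinitely often give a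
  sequence tending to 0.\<close>

lemma qpre_tendsto:
  assumes "\<gamma> \<in> Lam d" "\<beta> \<in> Lam d"
  shows "qpre \<gamma> \<beta> \<longlonglongrightarrow> qinf Q \<gamma> \<beta>"
proof -
  have "convergent (qpre \<gamma> \<beta>)"
  proof (cases "\<exists>N. \<forall>n\<ge>N. \<gamma> n = \<beta> n")
    case True
    then obtain N where N: "\<And>n. n \<ge> N \<Longrightarrow> \<gamma> n = \<beta> n" by blast
    have seg: "map \<gamma> [N..<m] = map \<beta> [N..<m]" for m using N by simp
    have split: "[0..<m] = [0..<N] @ [N..<m]" if "m \<ge> N" for m
      using that upt_add_eq_append[of 0 N "m - N"] by simp
    have "qpre \<gamma> \<beta> m = qpre \<gamma> \<beta> N" if "m \<ge> N" for m
    proof (cases "mset (map \<gamma> [0..<N]) = mset (map \<beta> [0..<N])")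
      case True
      then show ?thesis using qpre_split[OF True that] seg by simp
    next
      \<comment> \<open>Appending equal segments cannot repair unequal multisets, so both values are
        0.\<close>
      case False
      then have "mset (map \<gamma> [0..<m]) \<noteq> mset (map \<beta> [0..<m])"
        unfolding split[OF that] map_append mset_append seg by (metis add_right_cancel)
      with False show ?thesis using qpre_eq_0 by simp
    qed
    then have "qpre \<gamma> \<beta> \<longlonglongrightarrow> qpre \<gamma> \<beta> N"
      unfolding tendsto_def eventually_sequentially by metis
    then show ?thesis by (rule convergentI)
  next
    case False
    then have inf: "\<And>N. \<exists>n\<ge>N. \<gamma> n \<noteq> \<beta> n" by blast
    have "qpre \<gamma> \<beta> \<longlonglongrightarrow> 0"
    proof (rule LIMSEQ_I)
      fix e :: real assume "e > 0"
      then obtain k where "q_max ^ k < e"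
        using real_arch_pow_inv[of e q_max] q_max_less_1 by auto
      then show "\<exists>M. \<forall>m\<ge>M. norm (qpre \<gamma> \<beta> m - 0) < e"
        using qpre_power_bound[OF assms inf, of k] by (auto intro: order_le_less_trans)
    qed
    then show ?thesis by (rule convergentI)
  qed
  then show ?thesis
    unfolding convergent_LIMSEQ_iff qinf_def qpre_def .
qed

lemma psd_qinf:
  assumes "finite S" "S \<subseteq> Lam d"
  shows "psd_on S (qinf Q)"
  unfolding psd_on_def
proof
  fix x
  let ?z = "\<lambda>m. \<Sum>\<beta>\<in>S. \<Sum>\<gamma>\<in>S. x \<beta> * cnj (x \<gamma>) * qpre \<gamma> \<beta> m"
  let ?l = "\<Sum>\<beta>\<in>S. \<Sum>\<gamma>\<in>S. x \<beta> * cnj (x \<gamma>) * qinf Q \<gamma> \<beta>"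
  have lim: "?z \<longlonglongrightarrow> ?l"
    using assms(2) by (intro tendsto_sum tendsto_mult tendsto_const qpre_tendsto) auto
  have "psd_on S (\<lambda>\<gamma> \<beta>. qpre \<gamma> \<beta> m)" for m
    unfolding qpre_def using assms set_prefix by (intro psd_qfin) blast+
  then have nn: "Im (?z m) = 0" "Re (?z m) \<ge> 0" for m
    unfolding psd_on_def Let_def by blast+
  have "(\<lambda>m. Im (?z m)) \<longlonglongrightarrow> 0" by (simp only: nn(1) tendsto_const)
  then have "Im ?l = 0" by (rule LIMSEQ_unique[OF tendsto_Im[OF lim]])
  moreover have "Re ?l \<ge> 0"
    by (rule LIMSEQ_le_const[OF tendsto_Re[OF lim]]) (intro exI allI impI nn(2))
  ultimately show "let z = ?l in Im z = 0 \<and> Re z \<ge> 0" by simp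
qed

end

subsection \<open>Infinite words\<close>

lemma shift_funpow: "(shift ^^ m) \<beta> = (\<lambda>n. \<beta> (n + m))"
  by (induction m) (simp_all add: shift_def)

lemma sim_iff: "sim \<beta> \<alpha> \<longleftrightarrow> (\<exists>m n. \<forall>k. \<beta> (k + m) = \<alpha> (k + n))"
  by (simp add: sim_def shift_funpow fun_eq_iff)

lemma sim_refl [simp]: "sim \<alpha> \<alpha>"
  unfolding sim_def by blast

lemma sim_sym: "sim \<beta> \<alpha> \<Longrightarrow> sim \<alpha> \<beta>"
  unfolding sim_def by metis

lemma sim_trans:
  assumes "sim \<gamma> \<beta>" "sim \<beta> \<alpha>"
  shows "sim \<gamma> \<alpha>"
proof -
  obtain m n where 1: "\<And>k. \<gamma> (k + m) = \<beta> (k + n)" using assms(1) unfolding sim_iff by blast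
  obtain m' n' where 2: "\<And>k. \<beta> (k + m') = \<alpha> (k + n')" using assms(2) unfolding sim_iff by blast
  have "\<gamma> (k + (m + m')) = \<alpha> (k + (n + n'))" for k
    using 1[of "k + m'"] 2[of "k + n"] by (simp add: add_ac)
  then show ?thesis unfolding sim_iff by blast
qed

lemma Hspan_sim_eq: "sim \<alpha> \<alpha>' \<Longrightarrow> Hspan d \<alpha> = Hspan d \<alpha>'"
  unfolding Hspan_def by (auto intro: sim_trans sim_sym)

lemma sim_shift: "sim ((shift ^^ m) \<alpha>) \<alpha>"
  unfolding sim_def by (metis funpow_0)

lemma shift_in_Lam: "\<alpha> \<in> Lam d \<Longrightarrow> (shift ^^ m) \<alpha> \<in> Lam d"
  by (simp add: Lam_def shift_funpow)

lemma shift_shiftj [simp]: "shift (shiftj j \<beta>) = \<beta>"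
  by (simp add: shift_def shiftj_def)

lemma shiftj_shift: "shiftj (\<beta> 0) (shift \<beta>) = \<beta>"
  by (auto simp: shift_def shiftj_def fun_eq_iff split: nat.split)

lemma shiftj_0 [simp]: "shiftj j \<beta> 0 = j"
  by (simp add: shiftj_def)

lemma sim_shiftj: "sim (shiftj j \<beta>) \<beta>"
  unfolding sim_iff by (intro exI[of _ 1] exI[of _ 0]) (simp add: shiftj_def)

lemma shiftj_in_Lam: "j \<in> {1..d} \<Longrightarrow> \<beta> \<in> Lam d \<Longrightarrow> shiftj j \<beta> \<in> Lam d"
  by (auto simp: Lam_def shiftj_def split: nat.split)

text \<open>When \<open>p\<close> is the first position of \<open>j\<close>, this is the word that
  remains, up to a scalar, after the adjoint of the generator with index \<open>j\<close> acts on
  \<open>\<beta>\<close>.\<close>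

definition delete_at :: "nat \<Rightarrow> iword \<Rightarrow> iword" where
  "delete_at p \<beta> = (\<lambda>n. if n < p then \<beta> n else \<beta> (Suc n))"

lemma delete_at_0: "delete_at 0 \<beta> = shift \<beta>"
  by (simp add: delete_at_def shift_def)

lemma delete_at_in_Lam: "\<beta> \<in> Lam d \<Longrightarrow> delete_at p \<beta> \<in> Lam d"
  by (simp add: Lam_def delete_at_def)

lemma sim_delete_at: "sim (delete_at p \<beta>) \<beta>"
  unfolding sim_iff by (intro exI[of _ p] exI[of _ "Suc p"]) (simp add: delete_at_def)

subsection \<open>The form on the formal span\<close>

definition supp :: "fvec \<Rightarrow> iword set" where
  "supp x = {\<beta>. x \<beta> \<noteq> 0}"

definition single :: "iword \<Rightarrow> fvec" where
  "single \<beta> = (\<lambda>\<gamma>. if \<gamma> = \<beta> then 1 else 0)"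

definition lincomb :: "complex \<Rightarrow> fvec \<Rightarrow> complex \<Rightarrow> fvec \<Rightarrow> fvec" where
  "lincomb a x b y = (\<lambda>\<beta>. a * x \<beta> + b * y \<beta>)"

lemma diff_eq_lincomb: "x - y = lincomb 1 x (- 1) y"
  by (simp add: lincomb_def fun_eq_iff)

lemma supp_single [simp]: "supp (single \<beta>) = {\<beta>}"
  by (auto simp: supp_def single_def)

lemma supp_lincomb: "supp (lincomb a x b y) \<subseteq> supp x \<union> supp y"
  by (auto simp: supp_def lincomb_def)

lemma supp_piS: "supp (piS j x) = shiftj j ` supp x"
proof -
  have "\<gamma> \<in> shiftj j ` supp x" if "\<gamma> \<in> supp (piS j x)" for \<gamma>
    using that shiftj_shift[of \<gamma>] by (auto simp: supp_def piS_def image_iff split: if_splits)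
  then show ?thesis by (auto simp: supp_def piS_def)
qed

lemma piS_single: "piS j (single \<beta>) = single (shiftj j \<beta>)"
proof
  fix \<gamma>
  show "piS j (single \<beta>) \<gamma> = single (shiftj j \<beta>) \<gamma>"
    using shiftj_shift[of \<gamma>] by (auto simp: piS_def single_def)
qed

lemma Hspan_supp: "x \<in> Hspan d \<alpha> \<longleftrightarrow> finite (supp x) \<and> (\<forall>\<beta>\<in>supp x. \<beta> \<in> Lam d \<and> sim \<beta> \<alpha>)"
  by (auto simp: Hspan_def supp_def)

lemma single_in_Hspan: "\<beta> \<in> Lam d \<Longrightarrow> sim \<beta> \<alpha> \<Longrightarrow> single \<beta> \<in> Hspan d \<alpha>"
  by (simp add: Hspan_supp)

lemma piS_in_Hspan: "j \<in> {1..d} \<Longrightarrow> x \<in> Hspan d \<alpha> \<Longrightarrow> piS j x \<in> Hspan d \<alpha>"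
  using sim_trans[OF sim_shiftj] shiftj_in_Lam by (auto simp: Hspan_supp supp_piS)

text \<open>Extra indices contribute zero; a common index set is what makes sesquilinearity a
  computation with finite sums.\<close>

lemma form_superset:
  assumes "finite S" "supp x \<subseteq> S" "finite T" "supp y \<subseteq> T"
  shows "form Q x y = (\<Sum>\<beta>\<in>S. \<Sum>\<gamma>\<in>T. x \<beta> * cnj (y \<gamma>) * qinf Q \<gamma> \<beta>)"
proof -
  have "form Q x y = (\<Sum>\<beta>\<in>supp x. \<Sum>\<gamma>\<in>T. x \<beta> * cnj (y \<gamma>) * qinf Q \<gamma> \<beta>)"
    unfolding form_def supp_def[symmetric] using assms(3,4)
    by (intro sum.cong refl sum.mono_neutral_left) (auto simp: supp_def)
  also have "\<dots> = (\<Sum>\<beta>\<in>S. \<Sum>\<gamma>\<in>T. x \<beta> * cnj (y \<gamma>) * qinf Q \<gamma> \<beta>)"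
    using assms(1,2) by (intro sum.mono_neutral_left) (auto simp: supp_def)
  finally show ?thesis .
qed

lemma form_lincomb_left:
  assumes "finite (supp x)" "finite (supp y)" "finite (supp z)"
  shows "form Q (lincomb a x b y) z = a * form Q x z + b * form Q y z"
proof -
  let ?S = "supp x \<union> supp y" and ?T = "supp z"
  note form_superset[of ?S _ ?T z Q]
  then show ?thesis using assms supp_lincomb[of a x b y]
    by (simp add: lincomb_def ring_distribs sum.distrib sum_distrib_left mult.assoc)
qed

lemma form_lincomb_right:
  assumes "finite (supp x)" "finite (supp y)" "finite (supp z)"
  shows "form Q z (lincomb a x b y) = cnj a * form Q z x + cnj b * form Q z y"
proof -
  let ?S = "supp x \<union> supp y" and ?T = "supp z"
  note form_superset[of ?T z ?S _ Q]
  then show ?thesis using assms supp_lincomb[of a x b y]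
    by (simp add: lincomb_def ring_distribs sum.distrib sum_distrib_left mult_ac)
qed

lemma form_single_left: "form Q (single \<beta>) y = (\<Sum>\<gamma>\<in>supp y. cnj (y \<gamma>) * qinf Q \<gamma> \<beta>)"
  unfolding form_def supp_def[symmetric] supp_single by (simp add: single_def)

lemma form_eq_sum_single: "form Q x y = (\<Sum>\<beta>\<in>supp x. x \<beta> * form Q (single \<beta>) y)"
  unfolding form_single_left by (simp add: form_def supp_def sum_distrib_left mult.assoc)

lemma qinf_refl [simp]: "qinf Q \<beta> \<beta> = 1"
  by (simp add: qinf_def)

lemma form_single_single [simp]: "form Q (single \<beta>) (single \<beta>) = 1"
  by (simp add: form_single_left) (simp add: single_def)

lemma snorm_zero [simp]: "snorm Q (x - x) = 0"
  by (simp add: snorm_def form_def)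

lemma form_single_piS:
  "form Q (single \<beta>) (piS j y) = (\<Sum>\<gamma>\<in>supp y. cnj (y \<gamma>) * qinf Q (shiftj j \<gamma>) \<beta>)"
proof -
  have "inj_on (shiftj j) (supp y)" by (metis inj_onI shift_shiftj)
  then show ?thesis
    by (simp add: form_single_left supp_piS sum.reindex) (simp add: piS_def)
qed

text \<open>This is the formula for the adjoint of \<open>piS j\<close> on basis vectors. On
  prefixes it is one step of the recursion of \<open>qfin\<close>; removing \<open>j\<close>
  shortens the prefix of \<open>\<beta>\<close> by one, hence the lengths \<open>Suc m\<close> and
  \<open>m\<close>.\<close>

lemma (in q_system) qinf_shiftj:
  assumes "\<gamma> \<in> Lam d" "\<beta> \<in> Lam d" "\<beta> p = j" "\<And>n. n < p \<Longrightarrow> \<beta> n \<noteq> j"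
  shows "qinf Q (shiftj j \<gamma>) \<beta> = (\<Prod>b\<leftarrow>map \<beta> [0..<p]. Q j b) * qinf Q \<gamma> (delete_at p \<beta>)"
proof -
  let ?c = "\<Prod>b\<leftarrow>map \<beta> [0..<p]. Q j b"
  have j: "j \<in> {1..d}" using assms(2,3) by (auto simp: Lam_def)
  have step: "qpre (shiftj j \<gamma>) \<beta> (Suc m) = ?c * qpre \<gamma> (delete_at p \<beta>) m" if "p \<le> m" for m
  proof -
    have 1: "map (shiftj j \<gamma>) [0..<Suc m] = j # map \<gamma> [0..<m]"
      unfolding upt_conv_Cons[OF zero_less_Suc] map_Suc_upt[symmetric] by (simp add: shiftj_def)
    have up: "[0..<Suc m] = [0..<p] @ p # [Suc p..<Suc m]" "[0..<m] = [0..<p] @ [p..<m]"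
      using that upt_add_eq_append[of 0 p "Suc m - p"] upt_add_eq_append[of 0 p "m - p"] upt_conv_Cons[of p "Suc m"]
      by (simp_all del: upt_Suc)
    have 2: "map \<beta> [0..<Suc m] = map \<beta> [0..<p] @ j # map \<beta> [Suc p..<Suc m]"
      using up(1) assms(3) by simp
    have 3: "map (delete_at p \<beta>) [0..<m] = map \<beta> [0..<p] @ map \<beta> [Suc p..<Suc m]"
      unfolding up(2) map_Suc_upt[symmetric] by (auto simp: delete_at_def)
    have ni: "j \<notin> set (map \<beta> [0..<p])" using assms(4) by (metis atLeastLessThan_iff atLeastLessThan_upt imageE set_map)
    show ?thesis
      unfolding qpre_def 1 2 3 using ni by (simp add: qlet_append_notin remove1_append del: upt_Suc)
  qed
  have "(\<lambda>m. ?c * qpre \<gamma> (delete_at p \<beta>) m) \<longlonglongrightarrow> ?c * qinf Q \<gamma> (delete_at p \<beta>)"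
    using assms delete_at_in_Lam by (intro tendsto_intros qpre_tendsto)
  then have "(\<lambda>m. qpre (shiftj j \<gamma>) \<beta> (Suc m)) \<longlonglongrightarrow> ?c * qinf Q \<gamma> (delete_at p \<beta>)"
    by (rule Lim_transform_eventually) (auto simp: eventually_sequentially step intro!: exI[of _ p])
  moreover have "(\<lambda>m. qpre (shiftj j \<gamma>) \<beta> (Suc m)) \<longlonglongrightarrow> qinf Q (shiftj j \<gamma>) \<beta>"
    using assms shiftj_in_Lam[OF j] by (intro LIMSEQ_Suc qpre_tendsto) auto
  ultimately show ?thesis using LIMSEQ_unique by blast
qed

text \<open>The adjoint kills basis vectors whose word lacks \<open>j\<close>: every nonempty prefix
  of \<open>shiftj j \<gamma>\<close> contains \<open>j\<close>, so no prefixes balance.\<close>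

lemma (in q_system) qinf_shiftj_notin:
  assumes "\<And>n. \<beta> n \<noteq> j"
  shows "qinf Q (shiftj j \<gamma>) \<beta> = 0"
proof -
  have "qpre (shiftj j \<gamma>) \<beta> (Suc m) = 0" for m
  proof (rule qpre_eq_0)
    have "0 \<in> set [0..<Suc m]" by (simp del: upt_Suc)
    then have "j \<in> set (map (shiftj j \<gamma>) [0..<Suc m])" by (metis imageI set_map shiftj_0)
    moreover have "j \<notin> set (map \<beta> [0..<Suc m])" using assms by auto
    ultimately show "mset (map (shiftj j \<gamma>) [0..<Suc m]) \<noteq> mset (map \<beta> [0..<Suc m])"
      by (metis set_mset_mset)
  qed
  then have "qpre (shiftj j \<gamma>) \<beta> \<longlonglongrightarrow> 0"
    using LIMSEQ_imp_Suc[of "qpre (shiftj j \<gamma>) \<beta>" 0] by simp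
  then show ?thesis unfolding qinf_def qpre_def by (rule limI)
qed

subsection \<open>Cauchy-Schwarz and the completion\<close>

context q_system
begin

text \<open>Positivity holds across equivalence classes, so the estimates can be made for all words
  over the alphabet at once.\<close>

definition fin_vecs :: "fvec set" where
  "fin_vecs = {x. finite (supp x) \<and> supp x \<subseteq> Lam d}"

lemma fin_vecs_finite: "x \<in> fin_vecs \<Longrightarrow> finite (supp x)"
  by (simp add: fin_vecs_def)

lemma Hspan_fin_vecs: "x \<in> Hspan d \<alpha> \<Longrightarrow> x \<in> fin_vecs"
  by (auto simp: fin_vecs_def Hspan_supp)

lemma lincomb_fin_vecs: "x \<in> fin_vecs \<Longrightarrow> y \<in> fin_vecs \<Longrightarrow> lincomb a x b y \<in> fin_vecs"
  using supp_lincomb[of a x b y] by (auto simp: fin_vecs_def intro: finite_subset)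

lemma diff_fin_vecs: "x \<in> fin_vecs \<Longrightarrow> y \<in> fin_vecs \<Longrightarrow> x - y \<in> fin_vecs"
  by (simp add: diff_eq_lincomb lincomb_fin_vecs)

lemma form_nonneg: "x \<in> fin_vecs \<Longrightarrow> Im (form Q x x) = 0 \<and> Re (form Q x x) \<ge> 0"
  using psd_qinf[of "supp x"] by (simp add: fin_vecs_def psd_on_def Let_def form_def supp_def)

lemma snorm_nonneg: "x \<in> fin_vecs \<Longrightarrow> snorm Q x \<ge> 0"
  using form_nonneg by (simp add: snorm_def)

lemma form_eq_snorm_sq: "x \<in> fin_vecs \<Longrightarrow> form Q x x = complex_of_real ((snorm Q x)\<^sup>2)"
  using form_nonneg by (simp add: snorm_def complex_eq_iff)

lemma form_lincomb_self:
  assumes "x \<in> fin_vecs" "y \<in> fin_vecs"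
  shows "form Q (lincomb 1 x t y) (lincomb 1 x t y) =
    form Q x x + cnj t * form Q x y + t * form Q y x + t * cnj t * form Q y y"
proof -
  note fin = assms[THEN fin_vecs_finite] lincomb_fin_vecs[OF assms, THEN fin_vecs_finite]
  show ?thesis
    by (simp add: form_lincomb_left form_lincomb_right fin ring_distribs mult_ac)
qed

text \<open>Polarization: the values on x + y and x + iy are real, which compares the imaginary and
  the real parts respectively.\<close>

lemma form_cnj:
  assumes "x \<in> fin_vecs" "y \<in> fin_vecs"
  shows "form Q y x = cnj (form Q x y)"
proof -
  have *: "Im (cnj t * form Q x y + t * form Q y x) = 0" if "t * cnj t = 1" for t
    using form_nonneg[OF lincomb_fin_vecs[OF assms, of 1 t]] form_nonneg[OF assms(1)]
      form_nonneg[OF assms(2)] form_lincomb_self[OF assms, of t] that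
    by simp
  show ?thesis using *[of 1] *[of \<i>] by (simp add: complex_eq_iff)
qed

lemma form_cauchy_schwarz:
  assumes "x \<in> fin_vecs" "y \<in> fin_vecs"
  shows "cmod (form Q x y) \<le> snorm Q x * snorm Q y"
proof -
  define A C B where "A = Re (form Q x x)" and "C = Re (form Q y y)" and "B = form Q x y"
  have AC: "A \<ge> 0" "C \<ge> 0" using form_nonneg assms by (auto simp: A_def C_def)
  \<comment> \<open>Positivity at x - sBy, where the phase of \<open>B\<close> makes the cross terms
    real.\<close>
  have quad: "A - 2 * s * (cmod B)\<^sup>2 + s\<^sup>2 * (cmod B)\<^sup>2 * C \<ge> 0" for s :: real
  proof -
    let ?t = "- complex_of_real s * B"
    have "form Q x x = of_real A" "form Q y y = of_real C"
      using form_nonneg assms by (auto simp: A_def C_def complex_eq_iff)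
    then have "form Q (lincomb 1 x ?t y) (lincomb 1 x ?t y) =
       of_real A - 2 * of_real s * (B * cnj B) + (of_real s)\<^sup>2 * (B * cnj B) * of_real C"
      unfolding form_lincomb_self[OF assms] form_cnj[OF assms] B_def[symmetric]
      by (simp add: power2_eq_square algebra_simps)
    also have "\<dots> = of_real (A - 2 * s * (cmod B)\<^sup>2 + s\<^sup>2 * (cmod B)\<^sup>2 * C)"
      by (simp flip: complex_norm_square)
    finally show ?thesis using form_nonneg[OF lincomb_fin_vecs[OF assms, of 1 ?t]] by simp
  qed
  have "(cmod B)\<^sup>2 \<le> A * C"
  proof (cases "C = 0")
    case True
    have "(cmod B)\<^sup>2 = 0"
    proof (rule ccontr)
      assume "(cmod B)\<^sup>2 \<noteq> 0"
      \<comment> \<open>For \<open>C = 0\<close> the bound is affine in \<open>s\<close>, and this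
        \<open>s\<close> makes it negative; for positive \<open>C\<close> the minimizer 1/C is used
        below.\<close>
      then show False using quad[of "(A + 1) / (cmod B)\<^sup>2"] True AC by simp
    qed
    then show ?thesis using AC by simp
  next
    case False
    then show ?thesis using quad[of "1 / C"] AC by (simp add: field_simps power2_eq_square)
  qed
  then have "cmod B \<le> sqrt (A * C)" by (rule real_le_rsqrt)
  then show ?thesis by (simp add: snorm_def A_def B_def C_def real_sqrt_mult)
qed

lemma snorm_diff:
  assumes "x \<in> fin_vecs" "y \<in> fin_vecs"
  shows "\<bar>snorm Q x - snorm Q y\<bar> \<le> snorm Q (x - y)"
proof -
  have "Re (form Q (x - y) (x - y)) = (snorm Q x)\<^sup>2 + (snorm Q y)\<^sup>2 - 2 * Re (form Q x y)"
    using form_lincomb_self[OF assms, of "- 1"] form_cnj[OF assms] form_eq_snorm_sq assms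
    by (simp add: diff_eq_lincomb)
  moreover have "Re (form Q x y) \<le> snorm Q x * snorm Q y"
    using form_cauchy_schwarz[OF assms] complex_Re_le_cmod order_trans by blast
  ultimately have "(snorm Q x - snorm Q y)\<^sup>2 \<le> Re (form Q (x - y) (x - y))"
    by (simp add: power2_diff)
  then show ?thesis unfolding snorm_def[of Q "x - y"] by (intro real_le_rsqrt) simp
qed

lemma Hseq_fin_vecs: "Hseq d Q \<alpha> X \<Longrightarrow> X n \<in> fin_vecs"
  unfolding Hseq_def using Hspan_fin_vecs by blast

lemma form_diff_right:
  "x \<in> fin_vecs \<Longrightarrow> y \<in> fin_vecs \<Longrightarrow> z \<in> fin_vecs \<Longrightarrow> form Q z (x - y) = form Q z x - form Q z y"
  using form_lincomb_right[of x y z Q 1 "- 1"] fin_vecs_finite by (simp add: diff_eq_lincomb)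

lemma form_diff_left:
  "x \<in> fin_vecs \<Longrightarrow> y \<in> fin_vecs \<Longrightarrow> z \<in> fin_vecs \<Longrightarrow> form Q (x - y) z = form Q x z - form Q y z"
  using form_lincomb_left[of x y z Q 1 "- 1"] fin_vecs_finite by (simp add: diff_eq_lincomb)

lemma Hinner_const_tendsto:
  assumes "Hseq d Q \<alpha> X" "x \<in> fin_vecs"
  shows "(\<lambda>n. form Q x (X n)) \<longlonglongrightarrow> Hinner Q (\<lambda>_. x) X"
proof -
  have "Cauchy (\<lambda>n. form Q x (X n))"
  proof (rule CauchyI)
    fix e :: real assume e: "e > 0"
    have "snorm Q x \<ge> 0" using assms(2) by (rule snorm_nonneg)
    \<comment> \<open>Adding 1 keeps the divisor positive when \<open>x\<close> is a null
      vector.\<close>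
    then obtain N where N: "\<And>m n. m \<ge> N \<Longrightarrow> n \<ge> N \<Longrightarrow> snorm Q (X m - X n) < e / (snorm Q x + 1)"
      using assms(1) e unfolding Hseq_def by (metis add_nonneg_pos divide_pos_pos zero_less_one)
    have "cmod (form Q x (X m) - form Q x (X n)) < e" if "m \<ge> N" "n \<ge> N" for m n
    proof -
      have fv: "X m \<in> fin_vecs" "X n \<in> fin_vecs" using Hseq_fin_vecs[OF assms(1)] by auto
      have "cmod (form Q x (X m) - form Q x (X n)) \<le> snorm Q x * snorm Q (X m - X n)"
        using form_cauchy_schwarz[OF assms(2) diff_fin_vecs[OF fv]] fv assms(2)
        by (simp add: form_diff_right)
      also have "\<dots> \<le> (snorm Q x + 1) * snorm Q (X m - X n)"
        using snorm_nonneg diff_fin_vecs[OF fv] by (intro mult_right_mono) auto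
      also have "\<dots> < e" using N[OF that] \<open>snorm Q x \<ge> 0\<close> by (simp add: field_simps)
      finally show ?thesis .
    qed
    then show "\<exists>M. \<forall>m\<ge>M. \<forall>n\<ge>M. norm (form Q x (X m) - form Q x (X n)) < e" by blast
  qed
  then show ?thesis unfolding Hinner_def Cauchy_convergent_iff convergent_LIMSEQ_iff .
qed

lemma snorm_tendsto:
  assumes "Hseq d Q \<alpha> X"
  shows "(\<lambda>n. snorm Q (X n)) \<longlonglongrightarrow> sqrt (Re (Hinner Q X X))"
proof -
  have "Cauchy (\<lambda>n. snorm Q (X n))"
  proof (rule CauchyI)
    fix e :: real assume "e > 0"
    then obtain N where "\<And>m n. m \<ge> N \<Longrightarrow> n \<ge> N \<Longrightarrow> snorm Q (X m - X n) < e"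
      using assms unfolding Hseq_def by blast
    then show "\<exists>M. \<forall>m\<ge>M. \<forall>n\<ge>M. norm (snorm Q (X m) - snorm Q (X n)) < e"
      using snorm_diff Hseq_fin_vecs[OF assms] by (metis order_le_less_trans real_norm_def)
  qed
  then obtain l where l: "(\<lambda>n. snorm Q (X n)) \<longlonglongrightarrow> l"
    by (auto simp: Cauchy_convergent_iff convergent_def)
  have "(\<lambda>n. form Q (X n) (X n)) \<longlonglongrightarrow> complex_of_real (l\<^sup>2)"
    unfolding form_eq_snorm_sq[OF Hseq_fin_vecs[OF assms]] by (intro tendsto_intros l)
  then have "Hinner Q X X = complex_of_real (l\<^sup>2)" unfolding Hinner_def by (rule limI)
  moreover have "l \<ge> 0"
    using LIMSEQ_le_const[OF l] snorm_nonneg Hseq_fin_vecs[OF assms] by blast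
  ultimately show ?thesis using l by simp
qed

lemma Hinner_const_bound:
  assumes "Hseq d Q \<alpha> X" "x \<in> fin_vecs"
  shows "cmod (Hinner Q (\<lambda>_. x) X) \<le> snorm Q x * sqrt (Re (Hinner Q X X))"
proof (rule LIMSEQ_le)
  show "(\<lambda>n. cmod (form Q x (X n))) \<longlonglongrightarrow> cmod (Hinner Q (\<lambda>_. x) X)"
    by (rule tendsto_norm[OF Hinner_const_tendsto[OF assms]])
  show "(\<lambda>n. snorm Q x * snorm Q (X n)) \<longlonglongrightarrow> snorm Q x * sqrt (Re (Hinner Q X X))"
    by (intro tendsto_mult tendsto_const snorm_tendsto[OF assms(1)])
  show "\<exists>N. \<forall>n\<ge>N. cmod (form Q x (X n)) \<le> snorm Q x * snorm Q (X n)"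
    using form_cauchy_schwarz[OF assms(2)] Hseq_fin_vecs[OF assms(1)] by blast
qed

text \<open>\<open>X\<close> is approximated by its own term \<open>X N\<close>, a finite
  combination of basis vectors and hence orthogonal to \<open>X\<close>. So the squared norm of
  \<open>X\<close> is at most \<open>e\<close> times its norm, for every positive
  \<open>e\<close>.\<close>

lemma Hinner_eq_0_if_orthogonal:
  assumes X: "Hseq d Q \<alpha> X"
    and orth: "\<And>\<beta>. \<beta> \<in> Lam d \<Longrightarrow> sim \<beta> \<alpha> \<Longrightarrow> Hinner Q (\<lambda>_. single \<beta>) X = 0"
  shows "Re (Hinner Q X X) = 0"
proof -
  define l where "l = sqrt (Re (Hinner Q X X))"
  have lim: "(\<lambda>n. snorm Q (X n)) \<longlonglongrightarrow> l" unfolding l_def by (rule snorm_tendsto[OF X])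
  note fv = Hseq_fin_vecs[OF X]
  have l0: "l \<ge> 0" using LIMSEQ_le_const[OF lim] snorm_nonneg fv by blast
  have "l\<^sup>2 \<le> e * l" if e: "e > 0" for e
  proof -
    obtain N where N: "\<And>m n. m \<ge> N \<Longrightarrow> n \<ge> N \<Longrightarrow> snorm Q (X m - X n) < e"
      using X e unfolding Hseq_def by blast
    have "(\<lambda>n. form Q (X N) (X n)) \<longlonglongrightarrow> (\<Sum>\<beta>\<in>supp (X N). X N \<beta> * 0)"
      unfolding form_eq_sum_single[of Q "X N"]
    proof (intro tendsto_sum tendsto_mult tendsto_const)
      fix \<beta> assume "\<beta> \<in> supp (X N)"
      then have \<beta>: "\<beta> \<in> Lam d" "sim \<beta> \<alpha>" using X by (auto simp: Hseq_def Hspan_supp)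
      then have "single \<beta> \<in> fin_vecs" using single_in_Hspan Hspan_fin_vecs by blast
      from Hinner_const_tendsto[OF X this] show "(\<lambda>n. form Q (single \<beta>) (X n)) \<longlonglongrightarrow> 0"
        using orth[OF \<beta>] by simp
    qed
    then have z: "(\<lambda>n. cmod (form Q (X N) (X n))) \<longlonglongrightarrow> 0"
      using tendsto_norm_zero by simp
    have bound: "(snorm Q (X n))\<^sup>2 \<le> e * snorm Q (X n) + cmod (form Q (X N) (X n))" if "n \<ge> N" for n
    proof -
      have "complex_of_real ((snorm Q (X n))\<^sup>2) = form Q (X n - X N) (X n) + form Q (X N) (X n)"
        using form_eq_snorm_sq[OF fv] form_diff_left[OF fv fv fv] by simp
      then have "(snorm Q (X n))\<^sup>2 = cmod (form Q (X n - X N) (X n) + form Q (X N) (X n))"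
        by (metis abs_of_nonneg norm_of_real zero_le_power2)
      also have "\<dots> \<le> cmod (form Q (X n - X N) (X n)) + cmod (form Q (X N) (X n))"
        by (rule norm_triangle_ineq)
      also have "cmod (form Q (X n - X N) (X n)) \<le> snorm Q (X n - X N) * snorm Q (X n)"
        by (intro form_cauchy_schwarz diff_fin_vecs fv)
      also have "\<dots> \<le> e * snorm Q (X n)"
        using N[of n N] that snorm_nonneg[OF fv] by (intro mult_right_mono) auto
      finally show ?thesis by simp
    qed
    have "l\<^sup>2 \<le> e * l + 0"
      by (rule LIMSEQ_le[OF tendsto_power[OF lim] tendsto_add[OF tendsto_mult[OF tendsto_const lim] z]])
        (use bound in blast)
    then show ?thesis by simp
  qed
  from this[of "l / 2"] have "l = 0" using l0 by (cases "l = 0") (auto simp: power2_eq_square)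
  then show ?thesis by (simp add: l_def)
qed

end

subsection \<open>Intertwiners\<close>

context q_system
begin

text \<open>An intertwining relation is known only modulo null sequences; Cauchy-Schwarz allows it
  to be used inside inner products.\<close>

lemma Hinner_Heq_right:
  assumes "Hseq d Q \<alpha> X" "\<And>n. Y n \<in> fin_vecs" "Heq Q X Y" "x \<in> fin_vecs"
  shows "(\<lambda>n. form Q x (Y n)) \<longlonglongrightarrow> Hinner Q (\<lambda>_. x) X"
proof -
  note fX = Hseq_fin_vecs[OF assms(1)]
  have le: "cmod (form Q x (X n) - form Q x (Y n)) \<le> snorm Q x * snorm Q (X n - Y n)" for n
    using form_cauchy_schwarz[OF assms(4) diff_fin_vecs[OF fX assms(2)]]
      form_diff_right[OF fX assms(2,4)] by simp
  have lim: "(\<lambda>n. snorm Q x * snorm Q (X n - Y n)) \<longlonglongrightarrow> 0"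
    using tendsto_mult[OF tendsto_const assms(3)[unfolded Heq_def]] by simp
  have "(\<lambda>n. cmod (form Q x (X n) - form Q x (Y n))) \<longlonglongrightarrow> 0"
    by (rule real_tendsto_sandwich[OF _ _ tendsto_const lim]) (simp_all add: le)
  then have "(\<lambda>n. form Q x (X n) - form Q x (Y n)) \<longlonglongrightarrow> 0"
    by (rule tendsto_norm_zero_cancel)
  from tendsto_diff[OF Hinner_const_tendsto[OF assms(1,4)] this] show ?thesis by simp
qed

lemma form_single_piS_delete:
  assumes "y \<in> fin_vecs" "\<beta> \<in> Lam d" "\<beta> p = j" "\<And>n. n < p \<Longrightarrow> \<beta> n \<noteq> j"
  shows "form Q (single \<beta>) (piS j y) =
    (\<Prod>b\<leftarrow>map \<beta> [0..<p]. Q j b) * form Q (single (delete_at p \<beta>)) y"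
proof -
  let ?c = "\<Prod>b\<leftarrow>map \<beta> [0..<p]. Q j b"
  have "form Q (single \<beta>) (piS j y) = (\<Sum>\<gamma>\<in>supp y. cnj (y \<gamma>) * (?c * qinf Q \<gamma> (delete_at p \<beta>)))"
    unfolding form_single_piS using assms by (intro sum.cong) (auto simp: fin_vecs_def qinf_shiftj)
  then show ?thesis by (simp add: form_single_left sum_distrib_left mult_ac)
qed

lemma form_single_piS_notin:
  assumes "\<And>n. \<beta> n \<noteq> j"
  shows "form Q (single \<beta>) (piS j y) = 0"
  unfolding form_single_piS using qinf_shiftj_notin[OF assms] by simp

lemma cmod_prod_prefix_le_q_max:
  assumes "\<beta> \<in> Lam d" "j \<in> {1..d}" "0 < p" "\<And>n. n < p \<Longrightarrow> \<beta> n \<noteq> j"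
  shows "cmod (\<Prod>b\<leftarrow>map \<beta> [0..<p]. Q j b) \<le> q_max"
proof -
  have "cmod (\<Prod>b\<leftarrow>map \<beta> [0..<p]. Q j b) = cmod (Q j (\<beta> 0)) * cmod (\<Prod>b\<leftarrow>map \<beta> [Suc 0..<p]. Q j b)"
    using upt_conv_Cons[OF assms(3)] by (simp add: norm_mult)
  also have "\<dots> \<le> q_max * 1"
  proof (intro mult_mono Q_le_q_max cmod_prod_list_Q_le_1)
    show "j \<notin> set (map \<beta> [Suc 0..<p])"
      using assms(4) by (metis atLeastLessThan_iff atLeastLessThan_upt imageE set_map)
    show "set (map \<beta> [Suc 0..<p]) \<subseteq> {1..d}" using assms(1) by (rule set_prefix)
    show "\<beta> 0 \<in> {1..d}" using assms(1) by (simp add: Lam_def)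
    show "j \<noteq> \<beta> 0" using assms(3,4) by metis
  qed (use assms q_max_nonneg in auto)
  finally show ?thesis by simp
qed

text \<open>Here \<open>V m\<close> plays the role of the image of \<open>e\<^bsub>shift\<^sup>m \<alpha>\<^esub>\<close> under an intertwiner.\<close>
lemma coherent_unit_vectors_imp_sim:
  assumes \<alpha>: "\<alpha> \<in> Lam d"
    and V: "\<And>m. Hseq d Q \<alpha>' (V m)"
    and unit: "\<And>m. Hinner Q (V m) (V m) = 1"
    and step: "\<And>m. Heq Q (V m) (\<lambda>n. piS (\<alpha> m) (V (Suc m) n))"
  shows "sim \<alpha> \<alpha>'"
proof (rule ccontr)
  assume nsim: "\<not> sim \<alpha> \<alpha>'"
  define L where "L \<beta> m = Hinner Q (\<lambda>_. single \<beta>) (V m)" for \<beta> m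
  have \<alpha>_letter: "\<alpha> m \<in> {1..d}" for m using \<alpha> by (auto simp: Lam_def)
  have fv: "single \<beta> \<in> fin_vecs" if "\<beta> \<in> Lam d" for \<beta>
    using that single_in_Hspan[OF that sim_refl] Hspan_fin_vecs by blast
  have piS_fv: "piS (\<alpha> m) (V (Suc m) n) \<in> fin_vecs" for m n
    using piS_in_Hspan[OF \<alpha>_letter] V Hspan_fin_vecs unfolding Hseq_def by blast
  have lim: "(\<lambda>n. form Q (single \<beta>) (piS (\<alpha> m) (V (Suc m) n))) \<longlonglongrightarrow> L \<beta> m"
    if "\<beta> \<in> Lam d" for \<beta> m
    unfolding L_def by (rule Hinner_Heq_right[OF V piS_fv step fv[OF that]])
  have L_notin: "L \<beta> m = 0" if "\<beta> \<in> Lam d" "\<And>n. \<beta> n \<noteq> \<alpha> m" for \<beta> m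
    using lim[OF that(1), of m] form_single_piS_notin[OF that(2)]
    by (simp add: LIMSEQ_const_iff)
  \<comment> \<open>The generator in the coherence relation is moved onto the basis vector as its
    adjoint, which advances \<open>m\<close> by one.\<close>
  have L_delete: "L \<beta> m = (\<Prod>b\<leftarrow>map \<beta> [0..<p]. Q (\<alpha> m) b) * L (delete_at p \<beta>) (Suc m)"
    if \<beta>: "\<beta> \<in> Lam d" "\<beta> p = \<alpha> m" "\<And>n. n < p \<Longrightarrow> \<beta> n \<noteq> \<alpha> m" for \<beta> m p
  proof (rule LIMSEQ_unique[OF lim[OF \<beta>(1)]])
    have "form Q (single \<beta>) (piS (\<alpha> m) (V (Suc m) n)) =
        (\<Prod>b\<leftarrow>map \<beta> [0..<p]. Q (\<alpha> m) b) * form Q (single (delete_at p \<beta>)) (V (Suc m) n)" for n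
      using form_single_piS_delete[OF Hseq_fin_vecs[OF V] \<beta>] .
    then show "(\<lambda>n. form Q (single \<beta>) (piS (\<alpha> m) (V (Suc m) n))) \<longlonglongrightarrow>
        (\<Prod>b\<leftarrow>map \<beta> [0..<p]. Q (\<alpha> m) b) * L (delete_at p \<beta>) (Suc m)"
      unfolding L_def
      by (simp only:) (intro tendsto_mult tendsto_const Hinner_const_tendsto[OF V] fv delete_at_in_Lam \<beta>(1))
  qed
  have L_le_1: "cmod (L \<beta> m) \<le> 1" if "\<beta> \<in> Lam d" for \<beta> m
    using Hinner_const_bound[OF V fv[OF that], of m] unit by (simp add: L_def snorm_def)
  \<comment> \<open>Deleting the first letter costs no factor, so agreeing initial letters can be
    stripped from both words.\<close>
  have L_match: "L \<beta> m = L ((shift ^^ t) \<beta>) (m + t)"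
    if "\<beta> \<in> Lam d" "\<And>n. n < t \<Longrightarrow> \<beta> n = \<alpha> (m + n)" for \<beta> m t
    using that
  proof (induction t)
    case (Suc t)
    have "L ((shift ^^ t) \<beta>) (m + t) = L (delete_at 0 ((shift ^^ t) \<beta>)) (Suc (m + t))"
      using L_delete[OF shift_in_Lam[OF Suc.prems(1)], of t 0 "m + t"] Suc.prems(2)[of t]
      by (simp add: shift_funpow)
    then show ?case using Suc by (simp add: delete_at_0)
  qed simp
  text \<open>Following \<open>\<alpha>\<close> from position \<open>m\<close>, the first mismatch with \<open>\<beta>\<close> costs a factor \<open>q_max\<close>, and
    mismatches never stop occurring.\<close>
  have L_power: "cmod (L \<beta> m) \<le> q_max ^ k" if "\<beta> \<in> Lam d" "sim \<beta> \<alpha>'" for \<beta> m k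
    using that
  proof (induction k arbitrary: \<beta> m)
    case 0
    then show ?case using L_le_1 by simp
  next
    case (Suc k)
    \<comment> \<open>Without a mismatch \<open>\<beta>\<close> would be a tail of
      \<open>\<alpha>\<close>, and \<open>\<alpha>\<close> would be equivalent to
      \<open>\<alpha>'\<close>.\<close>
    have "\<exists>t. \<beta> t \<noteq> \<alpha> (m + t)"
    proof (rule ccontr)
      assume "\<nexists>t. \<beta> t \<noteq> \<alpha> (m + t)"
      then have "\<forall>k. \<alpha> (k + m) = \<beta> (k + 0)" by (simp add: add.commute)
      then have "sim \<alpha> \<beta>" unfolding sim_iff by blast
      with Suc.prems(2) nsim show False using sim_trans by blast
    qed
    then obtain t where t: "\<beta> t \<noteq> \<alpha> (m + t)" "\<And>n. n < t \<Longrightarrow> \<beta> n = \<alpha> (m + n)"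
      using exists_least_iff[of "\<lambda>t. \<beta> t \<noteq> \<alpha> (m + t)"] by blast
    define \<delta> j where "\<delta> = (shift ^^ t) \<beta>" and "j = \<alpha> (m + t)"
    have \<delta>: "\<delta> \<in> Lam d" "sim \<delta> \<alpha>'" "\<delta> 0 \<noteq> j"
      using Suc.prems shift_in_Lam sim_trans[OF sim_shift] t(1)
      by (auto simp: \<delta>_def j_def) (simp add: shift_funpow)
    have L\<delta>: "L \<beta> m = L \<delta> (m + t)" unfolding \<delta>_def by (rule L_match[OF Suc.prems(1) t(2)])
    show ?case
    proof (cases "\<exists>p. \<delta> p = j")
      case False
      then have "L \<delta> (m + t) = 0" by (intro L_notin \<delta>(1)) (auto simp: j_def)
      then show ?thesis using L\<delta> q_max_nonneg by simp
    next
      case True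
      then obtain p where p: "\<delta> p = j" "\<And>n. n < p \<Longrightarrow> \<delta> n \<noteq> j"
        using exists_least_iff[of "\<lambda>p. \<delta> p = j"] by blast
      have "p > 0" using p(1) \<delta>(3) by (cases p) auto
      have "L \<delta> (m + t) = (\<Prod>b\<leftarrow>map \<delta> [0..<p]. Q j b) * L (delete_at p \<delta>) (Suc (m + t))"
        using L_delete[OF \<delta>(1)] p unfolding j_def by blast
      then have "cmod (L \<beta> m) =
          cmod (\<Prod>b\<leftarrow>map \<delta> [0..<p]. Q j b) * cmod (L (delete_at p \<delta>) (Suc (m + t)))"
        by (simp add: L\<delta> norm_mult)
      \<comment> \<open>The deleted letter is not in front, which yields one factor
        \<open>q_max\<close>; deletion preserves the equivalence class, so the induction hypothesis
        applies.\<close>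
      also have "\<dots> \<le> q_max * q_max ^ k"
        using \<delta> sim_trans[OF sim_delete_at \<delta>(2)] p(2) \<open>p > 0\<close> \<alpha>_letter q_max_nonneg
        by (intro mult_mono cmod_prod_prefix_le_q_max Suc.IH delete_at_in_Lam) (simp_all add: j_def)
      finally show ?thesis by simp
    qed
  qed
  have "L \<beta> 0 = 0" if "\<beta> \<in> Lam d" "sim \<beta> \<alpha>'" for \<beta>
  proof (rule ccontr)
    assume "L \<beta> 0 \<noteq> 0"
    then obtain k where "q_max ^ k < cmod (L \<beta> 0)"
      using real_arch_pow_inv[of "cmod (L \<beta> 0)" q_max] q_max_less_1 by auto
    then show False using L_power[OF that, of 0 k] by simp
  qed
  then have "Re (Hinner Q (V 0) (V 0)) = 0"
    unfolding L_def by (rule Hinner_eq_0_if_orthogonal[OF V])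
  then show False by (simp add: unit)
qed

lemma unitarily_equivalent_imp_sim:
  assumes "unitarily_equivalent d Q \<alpha> \<alpha>'" "\<alpha> \<in> Lam d"
  shows "sim \<alpha> \<alpha>'"
proof -
  obtain U where U: "\<And>X. Hseq d Q \<alpha> X \<Longrightarrow> Hseq d Q \<alpha>' (U X)"
      "\<And>X Y. Hseq d Q \<alpha> X \<Longrightarrow> Hseq d Q \<alpha> Y \<Longrightarrow> Hinner Q (U X) (U Y) = Hinner Q X Y"
      "\<And>j X. j \<in> {1..d} \<Longrightarrow> Hseq d Q \<alpha> X \<Longrightarrow> Heq Q (U (\<lambda>n. piS j (X n))) (\<lambda>n. piS j (U X n))"
    using assms(1) unfolding unitarily_equivalent_def by blast
  define X where "X m = (\<lambda>_::nat. single ((shift ^^ m) \<alpha>))" for m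
  have X: "Hseq d Q \<alpha> (X m)" for m
    unfolding Hseq_def X_def
    using single_in_Hspan[OF shift_in_Lam[OF assms(2)] sim_shift] by simp
  \<comment> \<open>The first letter of the \<open>m\<close>-th shift is \<open>\<alpha> m\<close>,
    so these constant sequences satisfy the coherence relation exactly; \<open>U\<close> then
    transports it up to \<open>Heq\<close>.\<close>
  have X_Suc: "X m = (\<lambda>n. piS (\<alpha> m) (X (Suc m) n))" for m
    using shiftj_shift[of "(shift ^^ m) \<alpha>"] by (simp add: X_def piS_single shift_funpow)
  show ?thesis
  proof (rule coherent_unit_vectors_imp_sim[where V = "\<lambda>m. U (X m)", OF assms(2)])
    fix m
    show "Hseq d Q \<alpha>' (U (X m))" by (rule U(1)[OF X])
    show "Hinner Q (U (X m)) (U (X m)) = 1"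
      using U(2)[OF X X] by (simp add: Hinner_def X_def)
    have "\<alpha> m \<in> {1..d}" using assms(2) by (auto simp: Lam_def)
    from U(3)[OF this X[of "Suc m"]]
    show "Heq Q (U (X m)) (\<lambda>n. piS (\<alpha> m) (U (X (Suc m)) n))"
      by (simp flip: X_Suc)
  qed
qed

end

text \<open>Equivalent words have the same formal span, and neither the form nor \<open>piS\<close>
  depends on the word, so the identity serves as \<open>U\<close>.\<close>

lemma sim_imp_unitarily_equivalent:
  assumes "sim \<alpha> \<alpha>'"
  shows "unitarily_equivalent d Q \<alpha> \<alpha>'"
proof -
  have "Hseq d Q \<alpha> = Hseq d Q \<alpha>'"
    by (simp add: fun_eq_iff Hseq_def Hspan_sim_eq[OF assms])
  moreover have "Heq Q X X" for X by (simp add: Heq_def)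
  ultimately show ?thesis
    unfolding unitarily_equivalent_def by (intro exI[of _ id]) auto
qed

theorem mainTheorem5:
  fixes d :: nat and Q :: "nat \<Rightarrow> nat \<Rightarrow> complex" and \<alpha> \<alpha>' :: iword
  assumes "d \<ge> 2"
    and "\<forall>i\<in>{1..d}. \<forall>j\<in>{1..d}. i \<noteq> j \<longrightarrow> cmod (Q i j) < 1 \<and> Q i j = cnj (Q j i)"
    and "\<alpha> \<in> Lam d" and "\<alpha>' \<in> Lam d"
  shows "unitarily_equivalent d Q \<alpha> \<alpha>' \<longleftrightarrow> sim \<alpha> \<alpha>'"
proof -
  interpret q_system d Q
    using assms(2) by unfold_locales blast+
  show ?thesis
    using unitarily_equivalent_imp_sim[OF _ assms(3)] sim_imp_unitarily_equivalent by blast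
qed

end
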